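(* Let $s\ge1$ and $N\ge 0$ be integers. If $r:\{-N,\ldots,N\}\to\mathbb H^{s\times s}$ is positive definite, then $r$ has a positive definite extension, i.e. there exists a positive definite function $\tilde r:\mathbb Z\to\mathbb H^{s\times s}$ such that $\tilde r(n)=r(n)$ for $n=-N,\ldots,N$.
   Context: $\mathbb H$ denotes the quaternions. For an $\mathbb H^{s\times s}$-valued function $r$ defined at least on $\{-M,\ldots,M\}$, let $$\mathbb T_M=\begin{pmatrix}r(0)&r(1)&\cdots&r(M)\\ r(-1)&r(0)&\cdots&r(M-1)\\ \vdots&&&\vdots\\ r(-M)&r(1-M)&\cdots&r(0)\end{pmatrix}.$$ $T\succeq 0$ means that the quaternionic matrix $T$ is Hermitian and positive semidefinite. A function $r:\{-N,\ldots,N\}\to\mathbb H^{s\times s}$ is positive definite if $\mathbb T_N\succeq 0$. A function $\tilde r:\mathbb Z\to\mathbb H^{s\times s}$ is positive definite if $\mathbb T_M\succeq 0$ (formed with $\tilde r$) for every $M\ge 0$. *)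

theory Defs
  imports "HOL-Analysis.Finite_Cartesian_Product"
begin

section \<open>The quaternions\<close>

text \<open>\<^term>\<open>Quat a b c d\<close> stands for $a + b i + c j + d k$.\<close>

datatype quat = Quat (qRe: real) (qI: real) (qJ: real) (qK: real)

lemma quat_eq_iff:
  "p = q \<longleftrightarrow> qRe p = qRe q \<and> qI p = qI q \<and> qJ p = qJ q \<and> qK p = qK q"
  by (cases p; cases q) simp

instantiation quat :: real_div_algebra
begin

definition zero_quat :: quat where "zero_quat = Quat 0 0 0 0"

definition one_quat :: quat where "one_quat = Quat 1 0 0 0"

definition plus_quat :: "quat \<Rightarrow> quat \<Rightarrow> quat" where
  "plus_quat p q = Quat (qRe p + qRe q) (qI p + qI q) (qJ p + qJ q) (qK p + qK q)"

definition uminus_quat :: "quat \<Rightarrow> quat" where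
  "uminus_quat p = Quat (- qRe p) (- qI p) (- qJ p) (- qK p)"

definition minus_quat :: "quat \<Rightarrow> quat \<Rightarrow> quat" where
  "minus_quat p q = Quat (qRe p - qRe q) (qI p - qI q) (qJ p - qJ q) (qK p - qK q)"

definition times_quat :: "quat \<Rightarrow> quat \<Rightarrow> quat" where
  "times_quat p q = Quat
     (qRe p * qRe q - qI p * qI q - qJ p * qJ q - qK p * qK q)
     (qRe p * qI q + qI p * qRe q + qJ p * qK q - qK p * qJ q)
     (qRe p * qJ q - qI p * qK q + qJ p * qRe q + qK p * qI q)
     (qRe p * qK q + qI p * qJ q - qJ p * qI q + qK p * qRe q)"

definition scaleR_quat :: "real \<Rightarrow> quat \<Rightarrow> quat" where
  "scaleR_quat t p = Quat (t * qRe p) (t * qI p) (t * qJ p) (t * qK p)"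

definition inverse_quat :: "quat \<Rightarrow> quat" where
  "inverse_quat p =
     (1 / ((qRe p)\<^sup>2 + (qI p)\<^sup>2 + (qJ p)\<^sup>2 + (qK p)\<^sup>2)) *\<^sub>R
       Quat (qRe p) (- qI p) (- qJ p) (- qK p)"

definition divide_quat :: "quat \<Rightarrow> quat \<Rightarrow> quat" where
  "divide_quat p q = p * inverse q"

lemmas quat_defs = zero_quat_def one_quat_def plus_quat_def uminus_quat_def
  minus_quat_def times_quat_def scaleR_quat_def

instance
proof
  have norm_pos: "(qRe p)\<^sup>2 + (qI p)\<^sup>2 + (qJ p)\<^sup>2 + (qK p)\<^sup>2 \<noteq> 0" if "p \<noteq> 0" for p :: quat
    using that by (auto simp: quat_eq_iff quat_defs add_nonneg_eq_0_iff)
  fix p :: quat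
  assume "p \<noteq> 0"
  from norm_pos[OF this] show "inverse p * p = 1" "p * inverse p = 1"
    by (simp_all add: quat_eq_iff quat_defs inverse_quat_def)
       (simp_all add: divide_simps power2_eq_square)
qed (simp_all add: quat_eq_iff quat_defs inverse_quat_def divide_quat_def algebra_simps)

end

definition qcnj :: "quat \<Rightarrow> quat" where
  "qcnj p = Quat (qRe p) (- qI p) (- qJ p) (- qK p)"

lemma quat_units:
  "Quat 0 1 0 0 * Quat 0 1 0 0 = -1"
  "Quat 0 0 1 0 * Quat 0 0 1 0 = -1"
  "Quat 0 0 0 1 * Quat 0 0 0 1 = -1"
  "Quat 0 1 0 0 * Quat 0 0 1 0 * Quat 0 0 0 1 = -1"
  by (simp_all add: quat_eq_iff quat_defs)


section \<open>Positive semidefinite quaternionic matrices and positive definite functions\<close>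

text \<open>
  A square matrix with rows and columns indexed by a finite set \<open>I\<close> is a function
  \<open>A\<close> of two indices, of which only the values on \<open>I \<times> I\<close> matter. In the quadratic form
  $x^* A x$ the column vectors form a right quaternionic vector space; the requirement is that
  its value is a nonnegative real number.
\<close>

definition hermitian_on :: "'i set \<Rightarrow> ('i \<Rightarrow> 'i \<Rightarrow> quat) \<Rightarrow> bool" where
  "hermitian_on I A \<longleftrightarrow> (\<forall>i\<in>I. \<forall>j\<in>I. A i j = qcnj (A j i))"

definition psd_on :: "'i set \<Rightarrow> ('i \<Rightarrow> 'i \<Rightarrow> quat) \<Rightarrow> bool" where
  "psd_on I A \<longleftrightarrow> hermitian_on I A \<and>
     (\<forall>x :: 'i \<Rightarrow> quat. \<exists>t::real. t \<ge> 0 \<and>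
        (\<Sum>i\<in>I. \<Sum>j\<in>I. qcnj (x i) * A i j * x j) = of_real t)"

text \<open>
  The block matrix whose block in block row \<open>i\<close> and block column \<open>j\<close> is \<open>r (j - i)\<close>; the row
  \<open>(i, a)\<close> is row \<open>a\<close> of block row \<open>i\<close>, and similarly for columns.
\<close>

definition block_toeplitz ::
    "(int \<Rightarrow> quat ^ 's ^ 's) \<Rightarrow> nat \<times> 's \<Rightarrow> nat \<times> 's \<Rightarrow> quat" where
  "block_toeplitz r = (\<lambda>(i, a) (j, b). r (int j - int i) $ a $ b)"

text \<open>
  A function on $\{-N,\ldots,N\}$ is encoded as a function on all integers;
  \<open>pos_def_upto N r\<close> depends only on its values on $\{-N,\ldots,N\}$.
\<close>

definition pos_def_upto :: "nat \<Rightarrow> (int \<Rightarrow> quat ^ 's::finite ^ 's) \<Rightarrow> bool" where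
  "pos_def_upto N r \<longleftrightarrow> psd_on ({0..N} \<times> UNIV) (block_toeplitz r)"

definition pos_def :: "(int \<Rightarrow> quat ^ 's::finite ^ 's) \<Rightarrow> bool" where
  "pos_def r \<longleftrightarrow> (\<forall>M. psd_on ({0..M} \<times> UNIV) (block_toeplitz r))"

end

theory Submission
  imports Defs
begin

text \<open>
  It suffices to extend by one step, from $N$ to $N+1$. Only the two corner blocks of the new
  Toeplitz matrix are then free. Split the indices into the first block row $A$, the last one $B$ and
  the rest $C$: the parts on $A \<union> C$ and on $C \<union> B$ are both copies of the given matrix, hence
  positive semidefinite. The latter forces the columns of $R_{CB}$ into the range of $R_{CC}$, so
  that $R_{CB} = R_{CC} Y$ for some $Y$, and $R_{AC} Y$ is a suitable corner. This $Y$ is found by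
  eliminating the indices of $C$ one at a time, passing to Schur complements.
\<close>

section \<open>Conjugation and real parts of quaternions\<close>

lemma qcnj_simps [simp]:
  "qcnj (p + q) = qcnj p + qcnj q" "qcnj (p - q) = qcnj p - qcnj q" "qcnj (- p) = - qcnj p"
  "qcnj (p * q) = qcnj q * qcnj p" "qcnj (c *\<^sub>R p) = c *\<^sub>R qcnj p"
  "qcnj (qcnj p) = p" "qcnj 0 = 0" "qcnj 1 = 1"
  by (simp_all add: quat_eq_iff quat_defs qcnj_def algebra_simps)

lemma qRe_simps [simp]:
  "qRe (p + q) = qRe p + qRe q" "qRe (p - q) = qRe p - qRe q" "qRe (- p) = - qRe p"
  "qRe (c *\<^sub>R p) = c * qRe p" "qRe 0 = 0" "qRe 1 = 1" "qRe (qcnj p) = qRe p"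
  by (simp_all add: quat_defs qcnj_def)

lemma qRe_of_real [simp]: "qRe (of_real t) = t"
  by (simp add: of_real_def)

lemma qcnj_sum: "qcnj (sum f I) = (\<Sum>i\<in>I. qcnj (f i))"
  by (induction I rule: infinite_finite_induct) auto

lemma qcnj_eq_self_iff: "qcnj p = p \<longleftrightarrow> p = of_real (qRe p)"
  by (auto simp: quat_eq_iff of_real_def quat_defs qcnj_def)

lemma qRe_qcnj_mult_self_eq_0_iff: "qRe (qcnj p * p) = 0 \<longleftrightarrow> p = 0"
proof -
  have "qRe (qcnj p * p) = (qRe p)\<^sup>2 + (qI p)\<^sup>2 + (qJ p)\<^sup>2 + (qK p)\<^sup>2"
    by (simp add: quat_defs qcnj_def power2_eq_square)
  then show ?thesis
    by (auto simp: quat_eq_iff quat_defs add_nonneg_eq_0_iff)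
qed

lemma hermitian_on_qcnj: "hermitian_on I A \<Longrightarrow> i \<in> I \<Longrightarrow> j \<in> I \<Longrightarrow> qcnj (A i j) = A j i"
  unfolding hermitian_on_def by metis

section \<open>Sesquilinear forms on rectangular blocks\<close>

definition sesq ::
    "('i \<Rightarrow> 'i \<Rightarrow> quat) \<Rightarrow> 'i set \<Rightarrow> 'i set \<Rightarrow> ('i \<Rightarrow> quat) \<Rightarrow> ('i \<Rightarrow> quat) \<Rightarrow> quat" where
  "sesq R P S x y = (\<Sum>i\<in>P. \<Sum>j\<in>S. qcnj (x i) * R i j * y j)"

lemma sesq_alt: "sesq R P S x y = (\<Sum>i\<in>P. qcnj (x i) * (\<Sum>j\<in>S. R i j * y j))"
  by (simp add: sesq_def sum_distrib_left mult.assoc)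

lemma sesq_cong:
  assumes "\<And>i j. i \<in> P \<Longrightarrow> j \<in> S \<Longrightarrow> R i j = R' i j"
    and "\<And>i. i \<in> P \<Longrightarrow> x i = x' i" and "\<And>j. j \<in> S \<Longrightarrow> y j = y' j"
  shows "sesq R P S x y = sesq R' P S x' y'"
  unfolding sesq_def using assms by (intro sum.cong) auto

lemma qcnj_sesq:
  assumes "\<And>i j. i \<in> P \<Longrightarrow> j \<in> S \<Longrightarrow> R j i = qcnj (R i j)"
  shows "qcnj (sesq R P S x y) = sesq R S P y x"
proof -
  have "qcnj (sesq R P S x y) = (\<Sum>i\<in>P. \<Sum>j\<in>S. qcnj (y j) * R j i * x i)"
    unfolding sesq_def qcnj_sum using assms by (intro sum.cong) (auto simp: mult.assoc)
  then show ?thesis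
    unfolding sesq_def by (subst sum.swap)
qed

lemma sesq_add_left: "sesq R P S (\<lambda>i. x i + x' i) y = sesq R P S x y + sesq R P S x' y"
  by (simp add: sesq_def algebra_simps sum.distrib)

lemma sesq_add_right: "sesq R P S x (\<lambda>i. y i + y' i) = sesq R P S x y + sesq R P S x y'"
  by (simp add: sesq_def algebra_simps sum.distrib)

lemma sesq_minus_left: "sesq R P S (\<lambda>i. - x i) y = - sesq R P S x y"
  by (simp add: sesq_def sum_negf)

lemma sesq_minus_right: "sesq R P S x (\<lambda>i. - y i) = - sesq R P S x y"
  by (simp add: sesq_def sum_negf)

lemma sesq_Un_left:
  "finite P \<Longrightarrow> finite P' \<Longrightarrow> P \<inter> P' = {} \<Longrightarrow>
    sesq R (P \<union> P') S x y = sesq R P S x y + sesq R P' S x y"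
  by (simp add: sesq_def sum.union_disjoint)

lemma sesq_Un_right:
  "finite S \<Longrightarrow> finite S' \<Longrightarrow> S \<inter> S' = {} \<Longrightarrow>
    sesq R P (S \<union> S') x y = sesq R P S x y + sesq R P S' x y"
  by (simp add: sesq_def sum.union_disjoint sum.distrib)

section \<open>Positive semidefinite matrices: restriction and reindexing\<close>

text \<open>Hermitian symmetry makes the quadratic form equal to its own conjugate, hence real, so
  only the sign of its real part remains to be checked.\<close>

lemma psd_on_iff:
  "psd_on I R \<longleftrightarrow> hermitian_on I R \<and> (\<forall>x. qRe (sesq R I I x x) \<ge> 0)"
proof -
  have "sesq R I I x x = of_real (qRe (sesq R I I x x))" if "hermitian_on I R" for x
    using that qcnj_sesq[of I I R x x] qcnj_eq_self_iff
    unfolding hermitian_on_def by metis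
  then show ?thesis
    unfolding psd_on_def sesq_def[symmetric] by (metis qRe_of_real)
qed

lemma psd_on_cong:
  assumes "\<And>i j. i \<in> I \<Longrightarrow> j \<in> I \<Longrightarrow> R i j = R' i j"
  shows "psd_on I R \<longleftrightarrow> psd_on I R'"
proof -
  have "sesq R I I x x = sesq R' I I x x" for x
    by (intro sesq_cong) (use assms in auto)
  moreover have "hermitian_on I R \<longleftrightarrow> hermitian_on I R'"
    unfolding hermitian_on_def using assms by auto
  ultimately show ?thesis
    unfolding psd_on_iff by simp
qed

lemma psd_on_subset:
  assumes "psd_on I R" "J \<subseteq> I" "finite I"
  shows "psd_on J R"
  unfolding psd_on_iff
proof (intro conjI allI)
  show "hermitian_on J R"
    using assms by (auto simp: psd_on_def hermitian_on_def)
  fix x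
  \<comment> \<open>Extension by zero turns the form on \<open>J\<close> into a value of the form on
    \<open>I\<close>.\<close>
  define x' :: "'a \<Rightarrow> quat" where "x' = (\<lambda>i. if i \<in> J then x i else 0)"
  have "sesq R I I x' x' = sesq R J J x' x'"
    unfolding sesq_alt using assms(2,3)
    by (intro sum.mono_neutral_cong_right ballI arg_cong2[where f = times] refl)
       (auto simp: x'_def)
  also have "\<dots> = sesq R J J x x"
    by (intro sesq_cong) (auto simp: x'_def)
  finally show "qRe (sesq R J J x x) \<ge> 0"
    using assms(1) unfolding psd_on_iff by metis
qed

lemma psd_on_image:
  assumes "inj_on f I" "psd_on I (\<lambda>i j. R (f i) (f j))"
  shows "psd_on (f ` I) R"
proof -
  have "sesq R (f ` I) (f ` I) x x = sesq (\<lambda>i j. R (f i) (f j)) I I (x \<circ> f) (x \<circ> f)" for x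
    by (simp add: sesq_def sum.reindex[OF assms(1)])
  with assms(2) show ?thesis
    unfolding psd_on_iff hermitian_on_def ball_simps by metis
qed

section \<open>Elimination of one index and Schur complements\<close>

lemma hermitian_on_diag:
  "hermitian_on I R \<Longrightarrow> c \<in> I \<Longrightarrow> R c c = of_real (qRe (R c c))"
  unfolding hermitian_on_def using qcnj_eq_self_iff by metis

text \<open>The terms with exactly one index equal to \<open>c\<close> form a conjugate pair, since
  column \<open>c\<close> is the conjugate of row \<open>c\<close>; the single row sum
  \<open>s\<close> therefore describes both.\<close>

lemma sesq_insert:
  assumes "finite I" "c \<notin> I" "hermitian_on (insert c I) R" "R c c = of_real d"
    and s: "s = (\<Sum>j\<in>I. R c j * x j)"
  shows "sesq R (insert c I) (insert c I) x x =
    sesq R I I x x + qcnj (x c) * s + qcnj s * x c + d *\<^sub>R (qcnj (x c) * x c)"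
proof -
  have *: "(\<Sum>i\<in>I. qcnj (x i) * R i c * x c) = qcnj s * x c"
    unfolding s qcnj_sum sum_distrib_right
    by (intro sum.cong) (auto simp: hermitian_on_qcnj[OF assms(3)])
  show ?thesis
    using assms(1,2,4) *
    by (simp add: sesq_def sum.distrib s sum_distrib_left mult.assoc of_real_def)
qed

lemma psd_on_diag_nonneg:
  assumes "psd_on I R" "c \<in> I" "finite I"
  shows "qRe (R c c) \<ge> 0"
proof -
  have "psd_on {c} R"
    using assms by (auto intro: psd_on_subset)
  then have "qRe (sesq R {c} {c} (\<lambda>_. 1) (\<lambda>_. 1)) \<ge> 0"
    unfolding psd_on_iff by blast
  then show ?thesis
    by (simp add: sesq_def)
qed

text \<open>On the indices \<open>c\<close> and \<open>j\<close>, the vector with entries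
  \<open>- t *\<^sub>R R c j\<close> and \<open>1\<close> gives a form value that is affine in
  \<open>t\<close> with slope minus twice the squared norm of \<open>R c j\<close>. It stays
  nonnegative for all real \<open>t\<close> only if that slope vanishes.\<close>

lemma psd_on_row_eq_0:
  assumes psd: "psd_on I R" and "finite I" "c \<in> I" "j \<in> I" and 0: "R c c = 0"
  shows "R c j = 0"
proof (cases "j = c")
  case False
  have "psd_on {c, j} R"
    using assms by (auto intro: psd_on_subset)
  then have herm: "hermitian_on {c, j} R" and nonneg: "\<And>x. qRe (sesq R {c, j} {c, j} x x) \<ge> 0"
    unfolding psd_on_iff by auto
  have "0 \<le> qRe (R j j) - 2 * t * qRe (qcnj (R c j) * R c j)" for t
  proof -
    define x where "x = (\<lambda>i. if i = c then - t *\<^sub>R R c j else 1)"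
    have "sesq R {c, j} {c, j} x x =
        R j j - t *\<^sub>R (qcnj (R c j) * R c j) - t *\<^sub>R (qcnj (R c j) * R c j)"
      using False herm 0 by (subst sesq_insert[where d = 0 and s = "R c j"]) (auto simp: x_def sesq_alt)
    with nonneg[of x] show ?thesis
      by simp
  qed
  note bound = this
  have "qRe (qcnj (R c j) * R c j) = 0"
  proof (rule ccontr)
    assume *: "qRe (qcnj (R c j) * R c j) \<noteq> 0"
    \<comment> \<open>For this \<open>t\<close> the bound would read 0 <= -1.\<close>
    with bound[of "(qRe (R j j) + 1) / (2 * qRe (qcnj (R c j) * R c j))"] show False
      by simp
  qed
  then show ?thesis
    by (simp add: qRe_qcnj_mult_self_eq_0_iff)
qed (use 0 in auto)

text \<open>Completing the square in the variable at \<open>c\<close>: for fixed values on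
  \<open>I\<close> the form of \<open>R\<close> is smallest when that variable is -s/d, where
  \<open>s\<close> is the row sum at \<open>c\<close>, and its value there is the form of the Schur
  complement.\<close>

lemma psd_on_Schur:
  assumes psd: "psd_on (insert c I) R" and "finite I" "c \<notin> I" and d: "R c c = of_real d" "d > 0"
  shows "psd_on I (\<lambda>i j. R i j - (1 / d) *\<^sub>R (R i c * R c j))" (is "psd_on I ?S")
  unfolding psd_on_iff
proof (intro conjI allI)
  from psd have herm: "hermitian_on (insert c I) R"
    by (simp add: psd_on_def)
  show "hermitian_on I ?S"
    unfolding hermitian_on_def
  proof (intro ballI)
    fix i j assume "i \<in> I" "j \<in> I"
    then have "qcnj (R j i) = R i j" "qcnj (R c i) = R i c" "qcnj (R j c) = R c j"
      by (auto intro: hermitian_on_qcnj[OF herm])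
    then show "?S i j = qcnj (?S j i)"
      by simp
  qed
  fix x
  define s where "s = (\<Sum>j\<in>I. R c j * x j)"
  define x' where "x' = x(c := - (1 / d) *\<^sub>R s)"
  have s': "s = (\<Sum>j\<in>I. R c j * x' j)"
    unfolding s_def x'_def using \<open>c \<notin> I\<close> by (intro sum.cong) auto
  have "(\<Sum>i\<in>I. \<Sum>j\<in>I. qcnj (x i) * ((1 / d) *\<^sub>R (R i c * R c j)) * x j) =
      (\<Sum>i\<in>I. (1 / d) *\<^sub>R (qcnj (x i) * R i c * s))"
    by (simp add: s_def sum_distrib_left scaleR_sum_right mult.assoc)
  also have "\<dots> = (1 / d) *\<^sub>R ((\<Sum>i\<in>I. qcnj (x i) * R i c) * s)"
    by (simp add: sum_distrib_right scaleR_sum_right)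
  also have "(\<Sum>i\<in>I. qcnj (x i) * R i c) = qcnj s"
    unfolding s_def qcnj_sum by (intro sum.cong) (auto simp: hermitian_on_qcnj[OF herm])
  finally have "sesq ?S I I x x = sesq R I I x x - (1 / d) *\<^sub>R (qcnj s * s)"
    by (simp add: sesq_def right_diff_distrib left_diff_distrib sum_subtractf)
  moreover have "sesq R (insert c I) (insert c I) x' x' = sesq R I I x x - (1 / d) *\<^sub>R (qcnj s * s)"
  proof -
    have "sesq R I I x' x' = sesq R I I x x"
      unfolding x'_def using \<open>c \<notin> I\<close> by (intro sesq_cong) auto
    then show ?thesis
      using d by (subst sesq_insert[OF \<open>finite I\<close> \<open>c \<notin> I\<close> herm d(1) s']) (simp add: x'_def)
  qed
  ultimately show "qRe (sesq ?S I I x x) \<ge> 0"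
    using psd unfolding psd_on_iff by metis
qed

text \<open>Gaussian elimination with pivot \<open>R c c\<close>. A zero pivot has zero row and
  column, so \<open>c\<close> drops out; for a positive pivot the system of the Schur complement is
  solved first, and the unknown at \<open>c\<close> follows by back substitution. \<open>R\<close>
  varies in the induction because of this change of matrix.\<close>

lemma psd_on_solve:
  assumes "finite C" "b \<notin> C" "psd_on (insert b C) R"
  shows "\<exists>y. \<forall>i\<in>C. (\<Sum>j\<in>C. R i j * y j) = R i b"
  using assms
proof (induction C arbitrary: R rule: finite_induct)
  case (insert c C)
  from insert.prems have psd: "psd_on (insert c (insert b C)) R" and "b \<notin> C" "c \<noteq> b"
    by (auto simp: insert_commute)
  define d where "d = qRe (R c c)"
  from psd have herm: "hermitian_on (insert c (insert b C)) R"
    by (simp add: psd_on_def)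
  have d: "R c c = of_real d"
    unfolding d_def using herm by (rule hermitian_on_diag) simp
  have "d \<ge> 0"
    unfolding d_def using psd insert.hyps by (auto intro: psd_on_diag_nonneg)
  show ?case
  proof (cases "d = 0")
    case True
    \<comment> \<open>The equation at \<open>c\<close> becomes 0 = 0, and the value of
      \<open>y\<close> at \<open>c\<close> does not affect the other equations.\<close>
    have row: "R c j = 0" if "j \<in> insert c (insert b C)" for j
      using psd_on_row_eq_0[OF psd] insert.hyps that d True by auto
    have col: "R j c = 0" if "j \<in> insert c (insert b C)" for j
      using hermitian_on_qcnj[OF herm, of c j] row[OF that] that by simp
    obtain y where y: "\<forall>i\<in>C. (\<Sum>j\<in>C. R i j * y j) = R i b"
      using insert.IH[of R] psd_on_subset[OF psd] insert.hyps \<open>b \<notin> C\<close> by blast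
    show ?thesis
      by (rule exI[of _ y]) (use insert.hyps y row col in auto)
  next
    case False
    with \<open>d \<ge> 0\<close> have "d > 0" by simp
    let ?S = "\<lambda>i j. R i j - (1 / d) *\<^sub>R (R i c * R c j)"
    have "psd_on (insert b C) ?S"
      using psd_on_Schur[OF psd _ _ d \<open>d > 0\<close>] insert.hyps \<open>c \<noteq> b\<close> by auto
    with insert.IH[of ?S] \<open>b \<notin> C\<close> obtain y where y: "\<forall>i\<in>C. (\<Sum>j\<in>C. ?S i j * y j) = ?S i b"
      by blast
    define t where "t = (\<Sum>j\<in>C. R c j * y j)"
    \<comment> \<open>The new value solves row \<open>c\<close>, that is, d y'(c) + t =
      \<open>R c b\<close>.\<close>
    define y' where "y' = y(c := (1 / d) *\<^sub>R (R c b - t))"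
    have *: "(\<Sum>j\<in>insert c C. R i j * y' j) = R i c * (1 / d) *\<^sub>R (R c b - t) + (\<Sum>j\<in>C. R i j * y j)" for i
    proof -
      have "(\<Sum>j\<in>C. R i j * y' j) = (\<Sum>j\<in>C. R i j * y j)"
        unfolding y'_def using insert.hyps by (intro sum.cong) auto
      then show ?thesis
        using insert.hyps by (simp add: y'_def)
    qed
    show ?thesis
    proof (intro exI[of _ y'] ballI)
      fix i assume "i \<in> insert c C"
      then show "(\<Sum>j\<in>insert c C. R i j * y' j) = R i b"
      proof
        assume "i = c"
        then show ?thesis
          using \<open>d > 0\<close> unfolding * by (simp add: d of_real_def flip: t_def)
      next
        assume "i \<in> C"
        \<comment> \<open>The two correction terms of the Schur complement together are exactly the
          contribution of \<open>y' c\<close> to row \<open>i\<close>.\<close>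
        with y have "(\<Sum>j\<in>C. R i j * y j) - (1 / d) *\<^sub>R (R i c * t) = R i b - (1 / d) *\<^sub>R (R i c * R c b)"
          by (simp add: left_diff_distrib sum_subtractf t_def sum_distrib_left scaleR_sum_right mult.assoc)
        then show ?thesis
          unfolding * by (simp add: algebra_simps)
      qed
    qed
  qed
qed simp

section \<open>Completion of a matrix with a missing pair of corner blocks\<close>

lemma psd_completion:
  assumes fin: "finite A" "finite B" "finite C"
    and disj: "A \<inter> C = {}" "B \<inter> C = {}" "A \<inter> B = {}"
    and psd1: "psd_on (A \<union> C) R" and psd2: "psd_on (C \<union> B) R"
  shows "\<exists>X. psd_on (A \<union> C \<union> B) (\<lambda>i j. if i \<in> A \<and> j \<in> B then X i j
    else if i \<in> B \<and> j \<in> A then qcnj (X j i) else R i j)"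
proof -
  have "\<exists>y. \<forall>i\<in>C. (\<Sum>j\<in>C. R i j * y j) = R i b" if "b \<in> B" for b
    using that fin disj psd_on_subset[OF psd2] by (intro psd_on_solve) auto
  then obtain Y where Y: "\<And>b i. b \<in> B \<Longrightarrow> i \<in> C \<Longrightarrow> (\<Sum>j\<in>C. R i j * Y b j) = R i b"
    by metis
  \<comment> \<open>The formula is not confined to rows in \<open>A\<close>: on rows in
    \<open>C\<close> it reproduces \<open>R\<close>, by the choice of \<open>Y\<close>. Both cases
    are used below.\<close>
  define X where "X = (\<lambda>i b. \<Sum>j\<in>C. R i j * Y b j)"
  define R' where "R' = (\<lambda>i j. if i \<in> A \<and> j \<in> B then X i j
    else if i \<in> B \<and> j \<in> A then qcnj (X j i) else R i j)"
  have herm1: "R i j = qcnj (R j i)" if "i \<in> A \<union> C" "j \<in> A \<union> C" for i j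
    using psd1 that unfolding psd_on_def hermitian_on_def by blast
  have herm2: "R i j = qcnj (R j i)" if "i \<in> C \<union> B" "j \<in> C \<union> B" for i j
    using psd2 that unfolding psd_on_def hermitian_on_def by blast
  have herm': "R' i j = qcnj (R' j i)" if ij: "i \<in> A \<union> C \<union> B" "j \<in> A \<union> C \<union> B" for i j
  proof -
    \<comment> \<open>Outside the two corners, both indices lie in one of the two squares on which
      \<open>R\<close> is known to be Hermitian.\<close>
    consider "i \<in> A" "j \<in> B" | "i \<in> B" "j \<in> A"
      | "i \<in> A \<union> C" "j \<in> A \<union> C" | "i \<in> C \<union> B" "j \<in> C \<union> B"
      using ij by blast
    then show ?thesis
    proof cases
      case 3
      with disj have "i \<notin> B" "j \<notin> B" by auto
      with herm1[OF 3] show ?thesis by (simp add: R'_def)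
    next
      case 4
      with disj have "i \<notin> A" "j \<notin> A" by auto
      with herm2[OF 4] show ?thesis by (simp add: R'_def)
    qed (use disj in \<open>auto simp: R'_def\<close>)
  qed
  have "qRe (sesq R' (A \<union> C \<union> B) (A \<union> C \<union> B) x x) \<ge> 0" for x
  proof -
    \<comment> \<open>This is Y x_B. Through it every block pairing \<open>B\<close> with
      \<open>A\<close> or \<open>C\<close> is rewritten as a block of \<open>R\<close> on
      \<open>A\<close> and \<open>C\<close>, with \<open>z\<close> in place of the \<open>B\<close>
      part of \<open>x\<close>.\<close>
    define z where "z = (\<lambda>j. \<Sum>b\<in>B. Y b j * x b)"
    have Xz: "(\<Sum>b\<in>B. X i b * x b) = (\<Sum>j\<in>C. R i j * z j)" for i
      unfolding X_def z_def sum_distrib_left sum_distrib_right mult.assoc by (rule sum.swap)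
    have XC: "X i b = R i b" if "i \<in> C" "b \<in> B" for i b
      using Y that by (simp add: X_def)
    have CB: "sesq R C B u x = sesq R C C u z" for u
    proof -
      have "(\<Sum>j\<in>B. R i j * x j) = (\<Sum>j\<in>C. R i j * z j)" if "i \<in> C" for i
        using Xz[of i] XC[OF that] by simp
      then show ?thesis
        by (simp add: sesq_alt)
    qed
    have BC: "sesq R B C x u = sesq R C C z u" for u
    proof -
      have "sesq R B C x u = qcnj (sesq R C B u x)"
        by (rule qcnj_sesq[symmetric]) (auto intro: herm2)
      also have "\<dots> = sesq R C C z u"
        unfolding CB by (rule qcnj_sesq) (auto intro: herm2)
      finally show ?thesis .
    qed
    have "sesq R' A B x x = sesq X A B x x"
      by (intro sesq_cong) (auto simp: R'_def)
    also have "\<dots> = sesq R A C x z"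
      by (simp add: sesq_alt Xz)
    finally have AB: "sesq R' A B x x = sesq R A C x z" .
    have "sesq R' B A x x = qcnj (sesq R' A B x x)"
      by (rule qcnj_sesq[symmetric]) (auto intro: herm')
    also have "\<dots> = sesq R C A z x"
      unfolding AB by (rule qcnj_sesq) (auto intro: herm1)
    finally have BA: "sesq R' B A x x = sesq R C A z x" .
    have same: "sesq R' A A x x = sesq R A A x x" "sesq R' A C x x = sesq R A C x x"
      "sesq R' C A x x = sesq R C A x x" "sesq R' C C x x = sesq R C C x x"
      "sesq R' C B x x = sesq R C B x x" "sesq R' B C x x = sesq R B C x x"
      "sesq R' B B x x = sesq R B B x x"
      using disj by (auto intro!: sesq_cong simp: R'_def)
    \<comment> \<open>On \<open>C\<close>, where the two squares overlap, \<open>u\<close> and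
      \<open>v\<close> add up to \<open>x\<close>; on \<open>A\<close> and on \<open>B\<close>
      respectively they agree with \<open>x\<close>.\<close>
    define u where "u = (\<lambda>i. x i + (if i \<in> C then z i else 0))"
    define v where "v = (\<lambda>i. if i \<in> C then - z i else x i)"
    have u: "sesq R A A u u = sesq R A A x x" "sesq R A C u u = sesq R A C x (\<lambda>i. x i + z i)"
      "sesq R C A u u = sesq R C A (\<lambda>i. x i + z i) x"
      "sesq R C C u u = sesq R C C (\<lambda>i. x i + z i) (\<lambda>i. x i + z i)"
      using disj by (auto intro!: sesq_cong simp: u_def)
    have v: "sesq R B B v v = sesq R B B x x" "sesq R B C v v = sesq R B C x (\<lambda>i. - z i)"
      "sesq R C B v v = sesq R C B (\<lambda>i. - z i) x"
      "sesq R C C v v = sesq R C C (\<lambda>i. - z i) (\<lambda>i. - z i)"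
      using disj by (auto intro!: sesq_cong simp: v_def)
    have disj': "(A \<union> C) \<inter> B = {}" "C \<inter> B = {}"
      using disj by auto
    \<comment> \<open>Completing the square: $Q(x_A, x_C, x_B) = Q_{AC}(x_A, x_C + Y x_B) + Q_{CB}(- Y x_B, x_B)$.\<close>
    have "sesq R' (A \<union> C \<union> B) (A \<union> C \<union> B) x x =
        sesq R (A \<union> C) (A \<union> C) u u + sesq R (C \<union> B) (C \<union> B) v v"
      using fin disj disj'
      by (simp add: sesq_Un_left sesq_Un_right same AB BA CB BC u v
          sesq_add_left sesq_add_right sesq_minus_left sesq_minus_right)
    then show ?thesis
      using psd1 psd2 unfolding psd_on_iff by simp
  qed
  with herm' have "psd_on (A \<union> C \<union> B) R'"
    unfolding psd_on_iff hermitian_on_def by blast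
  then show ?thesis
    unfolding R'_def by blast
qed

section \<open>Extension of a positive definite function by one step\<close>

lemma block_toeplitz_simp [simp]: "block_toeplitz r (i, a) (j, b) = r (int j - int i) $ a $ b"
  by (simp add: block_toeplitz_def)

lemma pos_def_upto_cong:
  assumes "\<And>n. \<bar>n\<bar> \<le> int N \<Longrightarrow> r n = r' n"
  shows "pos_def_upto N r \<longleftrightarrow> pos_def_upto N r'"
  unfolding pos_def_upto_def using assms by (intro psd_on_cong) (auto simp: abs_le_iff)

lemma pos_def_upto_mono:
  assumes "pos_def_upto N r" "M \<le> N"
  shows "pos_def_upto M r"
  using assms unfolding pos_def_upto_def by (auto intro: psd_on_subset)

lemma pos_def_upto_Suc:
  fixes r :: "int \<Rightarrow> quat ^ 's::finite ^ 's"
  assumes r: "pos_def_upto N r"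
  shows "\<exists>r'. pos_def_upto (Suc N) r' \<and> (\<forall>n. \<bar>n\<bar> \<le> int N \<longrightarrow> r' n = r n)"
proof -
  define A B C :: "(nat \<times> 's) set"
    where "A = {0} \<times> UNIV" and "B = {Suc N} \<times> UNIV" and "C = {1..N} \<times> UNIV"
  have AC: "A \<union> C = {0..N} \<times> UNIV" and ACB: "A \<union> C \<union> B = {0..Suc N} \<times> UNIV"
    by (auto simp: A_def B_def C_def)
  have fin: "finite A" "finite B" "finite C"
    and disj: "A \<inter> C = {}" "B \<inter> C = {}" "A \<inter> B = {}"
    by (auto simp: A_def B_def C_def)
  \<comment> \<open>Shifting both block indices by one preserves their difference, so the Toeplitz
    matrix on \<open>C \<union> B\<close> is a copy of the given one.\<close>
  define f :: "nat \<times> 's \<Rightarrow> nat \<times> 's" where "f = map_prod Suc id"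
  have "C \<union> B = {1..Suc N} \<times> UNIV"
    by (auto simp: B_def C_def)
  also have "\<dots> = f ` ({0..N} \<times> UNIV)"
    unfolding f_def by (rule map_prod_surj_on[symmetric]) auto
  also have "psd_on \<dots> (block_toeplitz r)"
  proof (rule psd_on_image)
    have "block_toeplitz r (f i) (f j) = block_toeplitz r i j" for i j
      by (cases i; cases j) (simp add: f_def)
    with r show "psd_on ({0..N} \<times> UNIV) (\<lambda>i j. block_toeplitz r (f i) (f j))"
      by (simp add: pos_def_upto_def)
  qed (auto simp: f_def inj_on_def)
  finally have CB: "psd_on (C \<union> B) (block_toeplitz r)" .
  have "psd_on (A \<union> C) (block_toeplitz r)"
    using r unfolding AC pos_def_upto_def .
  with CB obtain X where X: "psd_on (A \<union> C \<union> B) (\<lambda>i j. if i \<in> A \<and> j \<in> B then X i j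
      else if i \<in> B \<and> j \<in> A then qcnj (X j i) else block_toeplitz r i j)"
    using psd_completion[of A B C "block_toeplitz r"] disj by (auto simp: fin)
  \<comment> \<open>The corner block becomes the value at N+1 and its conjugate transpose the value
    at -(N+1), hence the exchange of \<open>a\<close> and \<open>b\<close>.\<close>
  define r' where "r' = (\<lambda>n. if n = int (Suc N) then (\<chi> a b. X (0, a) (Suc N, b))
    else if - n = int (Suc N) then (\<chi> a b. qcnj (X (0, b) (Suc N, a))) else r n)"
  \<comment> \<open>The difference N+1 occurs in only one block position, so prescribing that block
    puts no constraint on other blocks.\<close>
  have corner: "int l - int k = int (Suc N) \<longleftrightarrow> k = 0 \<and> l = Suc N" if "k \<le> Suc N" "l \<le> Suc N" for k l
    using that by linarith
  have "pos_def_upto (Suc N) r'"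
    unfolding pos_def_upto_def using X unfolding ACB
    by (rule iffD1[OF psd_on_cong, rotated]) (auto simp: A_def B_def r'_def corner simp del: of_nat_Suc split: if_splits)
  then show ?thesis
    by (intro exI[of _ r']) (auto simp: r'_def)
qed

section \<open>Iteration of the one-step extension\<close>

theorem theorem6p3:
  fixes r :: "int \<Rightarrow> quat ^ 's::finite ^ 's" and N :: nat
  assumes "pos_def_upto N r"
  shows "\<exists>r' :: int \<Rightarrow> quat ^ 's ^ 's. pos_def r' \<and> (\<forall>n\<in>{- int N..int N}. r' n = r n)"
proof -
  \<comment> \<open>Dependent choice yields successive extensions; the clause for
    \<open>k = 0\<close> anchors the sequence at \<open>r\<close>.\<close>
  have "\<exists>f. \<forall>k. (pos_def_upto (N + k) (f k) \<and> (k = 0 \<longrightarrow> f k = r)) \<and>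
      (\<forall>n. \<bar>n\<bar> \<le> int (N + k) \<longrightarrow> f (Suc k) n = f k n)"
  proof (rule dependent_nat_choice)
    fix g k assume "pos_def_upto (N + k) g \<and> (k = 0 \<longrightarrow> g = r)"
    then show "\<exists>h. (pos_def_upto (N + Suc k) h \<and> (Suc k = 0 \<longrightarrow> h = r)) \<and>
        (\<forall>n. \<bar>n\<bar> \<le> int (N + k) \<longrightarrow> h n = g n)"
      using pos_def_upto_Suc[of "N + k" g] by auto
  qed (use assms in auto)
  then obtain f where f: "\<And>k. pos_def_upto (N + k) (f k)" "f 0 = r"
      "\<And>k n. \<bar>n\<bar> \<le> int (N + k) \<Longrightarrow> f (Suc k) n = f k n"
    by blast
  have f_eq: "f l n = f k n" if "k \<le> l" "\<bar>n\<bar> \<le> int (N + k)" for k l n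
    using that by (induction l rule: dec_induct) (auto simp: f(3))
  \<comment> \<open>The value at \<open>n\<close> no longer changes from stage |n| on, as |n| <= N +
    |n|; this diagonal function is thus the common limit of all stages.\<close>
  define r' where "r' = (\<lambda>n. f (nat \<bar>n\<bar>) n)"
  have r': "r' n = f k n" if "\<bar>n\<bar> \<le> int (N + k)" for k n
    unfolding r'_def using that f_eq[of k "nat \<bar>n\<bar>" n] f_eq[of "nat \<bar>n\<bar>" k n]
    by (cases "k \<le> nat \<bar>n\<bar>") auto
  have "pos_def_upto M r'" for M
  \<comment> \<open>The order is raised to \<open>N + M\<close>, where \<open>r'\<close> agrees with
    stage \<open>M\<close>.\<close>
  proof (rule pos_def_upto_mono)
    show "pos_def_upto (N + M) r'"
      using f(1)[of M] pos_def_upto_cong[of "N + M" r' "f M"] r' by blast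
  qed simp
  then have "pos_def r'"
    unfolding pos_def_def pos_def_upto_def by blast
  moreover have "\<forall>n\<in>{- int N..int N}. r' n = r n"
    using r'[of _ 0] f(2) by (auto simp: abs_le_iff)
  ultimately show ?thesis
    by blast
qed

end
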